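(* Let $\mathbf{x}^*$ be (the $\mathbf{x}$-part of) an optimal solution to the mixed integer program $$\min\ \mathbf{C}^T\mathbf{x}+\underline{\mathbf{c}}^T\mathbf{y}+\mathbf{u}^T\mathbf{b}\quad\text{s.t.}\quad \mathbf{H}(\mathbf{y}+\mathbf{x})\ge\mathbf{g},\ \mathbf{x}+\mathbf{y}\le\mathbf{1},\ \mathbf{u}^T\mathbf{A}\ge\mathbf{y}^T,\ \mathbf{x},\mathbf{y}\in\{0,1\}^n,\ \mathbf{u}\ge\mathbf{0}. \quad (\ast)$$ Then $\mathbf{x}^*\in\mathcal{X}'$ is a $\rho$-approximate first-stage solution to the robust two-stage problem, i.e. $\textsc{Eval}(\mathbf{x}^* )\le\rho\cdot\min_{\mathbf{x}\in\mathcal{X}'}\textsc{Eval}(\mathbf{x})$, where $\rho$ is the integrality gap of $(\ast)$, i.e. the ratio of the optimal value of $(\ast)$ to the optimal value of its LP relaxation (obtained by replacing $\mathbf{x},\mathbf{y}\in\{0,1\}^n$ with $\mathbf{0}\le\mathbf{x}\le\mathbf{1}$, $\mathbf{0}\le\mathbf{y}\le\mathbf{1}$).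
   Context: Let $\mathcal{X}=\{\mathbf{x}\in\{0,1\}^n:\mathbf{H}\mathbf{x}\ge\mathbf{g}\}$ (no integrality assumption on the associated polyhedron), $\mathbf{C}\in\mathbb{R}^n_{\ge0}$ the first-stage costs. For $\mathbf{x}\in\{0,1\}^n$ let $\mathcal{R}(\mathbf{x})=\{\mathbf{y}\in\{0,1\}^n:\mathbf{x}+\mathbf{y}\in\mathcal{X}\}$ and $\mathcal{X}'=\{\mathbf{x}\in\{0,1\}^n:\mathcal{R}(\mathbf{x})\ne\emptyset\}$. The uncertainty set is $\mathcal{U}^{\mathcal{HP}}=\{\underline{\mathbf{c}}+\boldsymbol{\delta}:\mathbf{A}\boldsymbol{\delta}\le\mathbf{b},\boldsymbol{\delta}\ge\mathbf{0}\}\subset\mathbb{R}^n_+$, bounded. For $\mathbf{x}\in\mathcal{X}'$, $\textsc{Eval}(\mathbf{x})=\mathbf{C}^T\mathbf{x}+\max_{\mathbf{c}\in\mathcal{U}^{\mathcal{HP}}}\min_{\mathbf{y}\in\mathcal{R}(\mathbf{x})}\mathbf{c}^T\mathbf{y}$, and the robust two-stage problem is $\min_{\mathbf{x}\in\mathcal{X}'}\textsc{Eval}(\mathbf{x})$. *)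

theory Defs
  imports "HOL-Analysis.Analysis"
begin

text \<open>Orders on vectors are componentwise, and \<open>1\<close> is the all-ones vector.\<close>

definition binary_vectors :: "(real ^ 'n) set" where
  "binary_vectors = {x. \<forall>i. x $ i \<in> {0, 1}}"

definition solutions :: "real ^ 'n ^ 'm \<Rightarrow> real ^ 'm \<Rightarrow> (real ^ 'n) set" where
  "solutions H g = {x \<in> binary_vectors. g \<le> H *v x}"

definition recourse :: "real ^ 'n ^ 'm \<Rightarrow> real ^ 'm \<Rightarrow> real ^ 'n \<Rightarrow> (real ^ 'n) set" where
  "recourse H g x = {y \<in> binary_vectors. x + y \<in> solutions H g}"

definition first_stage :: "real ^ 'n ^ 'm \<Rightarrow> real ^ 'm \<Rightarrow> (real ^ 'n) set" where
  "first_stage H g = {x \<in> binary_vectors. recourse H g x \<noteq> {}}"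

definition uncertainty_set ::
  "real ^ 'n \<Rightarrow> real ^ 'n ^ 'k \<Rightarrow> real ^ 'k \<Rightarrow> (real ^ 'n) set" where
  "uncertainty_set c A b = {c + \<delta> |\<delta>. A *v \<delta> \<le> b \<and> 0 \<le> \<delta>}"

text \<open>The inner minimum ranges over a finite set, nonempty for a first-stage solution \<open>x\<close>.
  The outer supremum is an attained maximum whenever the closed set \<open>U\<close> is bounded and
  nonempty, since the inner minimum is continuous in \<open>c\<close>. Nonemptiness of the uncertainty set
  follows, by Farkas' lemma, from the existence of an optimal solution of the mixed integer
  program below.\<close>

definition Eval ::
  "real ^ 'n ^ 'm \<Rightarrow> real ^ 'm \<Rightarrow> real ^ 'n \<Rightarrow> (real ^ 'n) set \<Rightarrow> real ^ 'n \<Rightarrow> real" where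
  "Eval H g C U x = C \<bullet> x + (SUP c\<in>U. Min ((\<lambda>y. c \<bullet> y) ` recourse H g x))"

definition robust_two_stage_opt ::
  "real ^ 'n ^ 'm \<Rightarrow> real ^ 'm \<Rightarrow> real ^ 'n \<Rightarrow> (real ^ 'n) set \<Rightarrow> real" where
  "robust_two_stage_opt H g C U = Min (Eval H g C U ` first_stage H g)"

text \<open>The constraints common to the mixed integer program and its LP relaxation;
  \<open>D\<close> is the domain of \<open>x\<close> and \<open>y\<close>.\<close>

definition program_feasible ::
  "(real ^ 'n) set \<Rightarrow> real ^ 'n ^ 'm \<Rightarrow> real ^ 'm \<Rightarrow> real ^ 'n ^ 'k
     \<Rightarrow> ((real ^ 'n) \<times> (real ^ 'n) \<times> (real ^ 'k)) set" where
  "program_feasible D H g A =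
     {(x, y, u). g \<le> H *v (y + x) \<and> x + y \<le> 1 \<and> y \<le> u v* A \<and> x \<in> D \<and> y \<in> D \<and> 0 \<le> u}"

definition mip_feasible ::
  "real ^ 'n ^ 'm \<Rightarrow> real ^ 'm \<Rightarrow> real ^ 'n ^ 'k \<Rightarrow> ((real ^ 'n) \<times> (real ^ 'n) \<times> (real ^ 'k)) set" where
  "mip_feasible = program_feasible binary_vectors"

definition lp_feasible ::
  "real ^ 'n ^ 'm \<Rightarrow> real ^ 'm \<Rightarrow> real ^ 'n ^ 'k \<Rightarrow> ((real ^ 'n) \<times> (real ^ 'n) \<times> (real ^ 'k)) set" where
  "lp_feasible = program_feasible {x. 0 \<le> x \<and> x \<le> 1}"

definition program_cost ::
  "real ^ 'n \<Rightarrow> real ^ 'n \<Rightarrow> real ^ 'k \<Rightarrow> (real ^ 'n) \<times> (real ^ 'n) \<times> (real ^ 'k) \<Rightarrow> real" where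
  "program_cost C c b = (\<lambda>(x, y, u). C \<bullet> x + c \<bullet> y + u \<bullet> b)"

definition mip_opt ::
  "real ^ 'n ^ 'm \<Rightarrow> real ^ 'm \<Rightarrow> real ^ 'n \<Rightarrow> real ^ 'n \<Rightarrow> real ^ 'n ^ 'k \<Rightarrow> real ^ 'k \<Rightarrow> real" where
  "mip_opt H g C c A b = (INF z\<in>mip_feasible H g A. program_cost C c b z)"

definition lp_opt ::
  "real ^ 'n ^ 'm \<Rightarrow> real ^ 'm \<Rightarrow> real ^ 'n \<Rightarrow> real ^ 'n \<Rightarrow> real ^ 'n ^ 'k \<Rightarrow> real ^ 'k \<Rightarrow> real" where
  "lp_opt H g C c A b = (INF z\<in>lp_feasible H g A. program_cost C c b z)"

text \<open>The ratio is taken in \<^typ>\<open>ereal\<close>, so that it is \<open>\<infinity>\<close> if the LP value is \<open>0\<close> and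
  the MIP value is positive. If both values are \<open>0\<close>, the quotient is \<open>0\<close>; a bound with this
  factor is at least as strong as with the usual convention \<open>0 / 0 = 1\<close>, as all
  costs involved are nonnegative.\<close>

definition integrality_gap ::
  "real ^ 'n ^ 'm \<Rightarrow> real ^ 'm \<Rightarrow> real ^ 'n \<Rightarrow> real ^ 'n \<Rightarrow> real ^ 'n ^ 'k \<Rightarrow> real ^ 'k \<Rightarrow> ereal" where
  "integrality_gap H g C c A b = ereal (mip_opt H g C c A b) / ereal (lp_opt H g C c A b)"

end

theory Submission
  imports Defs
begin

text \<open>The optimal value of the mixed integer program bounds \<open>Eval x\<close> from above, because the player
  may commit to \<open>y\<close> before seeing the scenario and \<open>u\<close> is a dual certificate for the worst case of
  \<open>y\<close>. Conversely, by the minimax theorem and linear programming duality, \<open>Eval x'\<close> is the cost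
  of \<open>(x', y', u')\<close> for some convex combination \<open>y'\<close> of recourse actions. This triple is feasible
  for the relaxation, so the LP value is at most the optimum of the two-stage problem.
  Both dualities are obtained at once by separating a point from a finitely generated cone.
  If the two-stage optimum is \<open>0\<close>, so is the value of the mixed integer program; this rules out
  the product \<open>\<infinity> * 0 = 0\<close> in the bound.\<close>

section \<open>Componentwise order, binary vectors and recourse actions\<close>

lemma inner_left_mono_vec:
  fixes v w z :: "real ^ 'n"
  assumes "v \<le> w" "0 \<le> z"
  shows "v \<bullet> z \<le> w \<bullet> z"
  using assms by (auto simp: inner_vec_def less_eq_vec_def intro!: sum_mono mult_right_mono)

lemma inner_nonneg_vec:
  fixes v z :: "real ^ 'n"
  assumes "0 \<le> v" "0 \<le> z"
  shows "0 \<le> v \<bullet> z"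
  using inner_left_mono_vec[OF assms] by simp

lemma finite_binary_vectors: "finite (binary_vectors :: (real ^ 'n) set)"
proof -
  have eq: "(binary_vectors :: (real ^ 'n) set) = vec_lambda ` (UNIV \<rightarrow>\<^sub>E {0, 1 :: real})"
  proof (intro set_eqI iffI)
    fix v :: "real ^ 'n" assume "v \<in> binary_vectors"
    then have "vec_nth v \<in> (UNIV \<rightarrow>\<^sub>E {0, 1 :: real})"
      by (auto simp: binary_vectors_def PiE_def)
    then show "v \<in> vec_lambda ` (UNIV \<rightarrow>\<^sub>E {0, 1 :: real})"
      by (metis image_eqI vec_nth_inverse)
  qed (auto simp: binary_vectors_def PiE_def)
  have "finite (UNIV \<rightarrow>\<^sub>E {0, 1 :: real} :: ('n \<Rightarrow> real) set)"
    by (intro finite_PiE) simp_all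
  then show ?thesis
    unfolding eq by (rule finite_imageI)
qed

lemma binary_vectors_bounds:
  "v \<in> binary_vectors \<Longrightarrow> 0 \<le> v" "v \<in> binary_vectors \<Longrightarrow> v \<le> 1"
  by (simp_all add: binary_vectors_def less_eq_vec_def)
     (metis insert_iff order.refl singletonD zero_le_one)+

lemma finite_recourse: "finite (recourse H g x)"
  unfolding recourse_def by (rule finite_subset[OF _ finite_binary_vectors]) auto

text \<open>Two entries from {0, 1} sum to 0 or 1 exactly when the sum is at most 1, so binarity of
  \<open>x + y\<close> becomes a linear constraint of the program.\<close>

lemma recourse_iff:
  assumes "x \<in> binary_vectors"
  shows "y \<in> recourse H g x \<longleftrightarrow> y \<in> binary_vectors \<and> x + y \<le> 1 \<and> g \<le> H *v (y + x)"
proof -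
  have "x + y \<in> binary_vectors \<longleftrightarrow> x + y \<le> 1" if "y \<in> binary_vectors"
  proof -
    have "x $ i + y $ i \<in> {0, 1} \<longleftrightarrow> x $ i + y $ i \<le> 1" for i
      using assms that by (auto simp: binary_vectors_def) (smt (verit))
    then show ?thesis
      by (auto simp: binary_vectors_def less_eq_vec_def)
  qed
  then show ?thesis
    by (auto simp: recourse_def solutions_def add.commute)
qed

section \<open>A Farkas alternative by separation from a cone\<close>

text \<open>A point \<open>(1, 0, q)\<close> of the cone is a mixed recourse over \<open>Y\<close>, with a dual certificate that its
  cost is at most \<open>q\<close> in every scenario; a point \<open>(0, 0, q)\<close> with \<open>q < 0\<close> certifies
  that there are no scenarios.\<close>

definition farkas_cone ::
  "(real ^ 'n) set \<Rightarrow> real ^ 'n \<Rightarrow> real ^ 'n ^ 'k \<Rightarrow> real ^ 'k \<Rightarrow> (real \<times> (real ^ 'n) \<times> real) set" where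
  "farkas_cone Y c A b = {(p, z, q). \<exists>w u. (\<forall>y\<in>Y. 0 \<le> w y) \<and> 0 \<le> u \<and> sum w Y = p \<and>
     (\<Sum>y\<in>Y. w y *\<^sub>R y) \<le> u v* A + z \<and> c \<bullet> (\<Sum>y\<in>Y. w y *\<^sub>R y) + u \<bullet> b \<le> q}"

text \<open>The constraints are homogeneous in \<open>w\<close>, \<open>u\<close>, \<open>p\<close>,
  \<open>z\<close> and \<open>q\<close> jointly, so witnesses may be added and scaled. This puts the
  hull of any set of cone points back inside the cone.\<close>

lemma convex_cone_farkas_cone: "convex_cone (farkas_cone Y c A b)"
  unfolding convex_cone_iff
proof (intro conjI allI impI ballI)
  show "0 \<in> farkas_cone Y c A b"
    unfolding farkas_cone_def zero_prod_def
    by (auto intro!: exI[of _ "\<lambda>_. 0"] exI[of _ 0])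
next
  fix s t assume "s \<in> farkas_cone Y c A b" "t \<in> farkas_cone Y c A b"
  moreover obtain p z q p' z' q' where st: "s = (p, z, q)" "t = (p', z', q')"
    by (metis prod_cases3)
  ultimately obtain w u w' u' where
    "\<forall>y\<in>Y. 0 \<le> w y" "0 \<le> u" "sum w Y = p" "(\<Sum>y\<in>Y. w y *\<^sub>R y) \<le> u v* A + z"
    "c \<bullet> (\<Sum>y\<in>Y. w y *\<^sub>R y) + u \<bullet> b \<le> q"
    "\<forall>y\<in>Y. 0 \<le> w' y" "0 \<le> u'" "sum w' Y = p'" "(\<Sum>y\<in>Y. w' y *\<^sub>R y) \<le> u' v* A + z'"
    "c \<bullet> (\<Sum>y\<in>Y. w' y *\<^sub>R y) + u' \<bullet> b \<le> q'"
    unfolding farkas_cone_def by auto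
  moreover from this have "(\<Sum>y\<in>Y. w y *\<^sub>R y) + (\<Sum>y\<in>Y. w' y *\<^sub>R y) \<le> (u + u') v* A + (z + z')"
    using add_mono[of "\<Sum>y\<in>Y. w y *\<^sub>R y" "u v* A + z" "\<Sum>y\<in>Y. w' y *\<^sub>R y" "u' v* A + z'"]
    by (simp add: vector_matrix_left_distrib algebra_simps)
  ultimately show "s + t \<in> farkas_cone Y c A b"
    unfolding farkas_cone_def st
    by (auto intro!: exI[of _ "\<lambda>y. w y + w' y"] exI[of _ "u + u'"]
        simp: sum.distrib scaleR_left_distrib inner_add_left inner_add_right)
next
  fix s and r :: real assume "s \<in> farkas_cone Y c A b" and r: "0 \<le> r"
  moreover obtain p z q where s: "s = (p, z, q)"
    by (metis prod_cases3)
  ultimately obtain w u where *: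
    "\<forall>y\<in>Y. 0 \<le> w y" "0 \<le> u" "sum w Y = p" "(\<Sum>y\<in>Y. w y *\<^sub>R y) \<le> u v* A + z"
    "c \<bullet> (\<Sum>y\<in>Y. w y *\<^sub>R y) + u \<bullet> b \<le> q"
    unfolding farkas_cone_def by auto
  have sum: "(\<Sum>y\<in>Y. (r * w y) *\<^sub>R y) = r *\<^sub>R (\<Sum>y\<in>Y. w y *\<^sub>R y)"
    by (simp add: scaleR_sum_right)
  have "(\<Sum>y\<in>Y. (r * w y) *\<^sub>R y) \<le> (r *\<^sub>R u) v* A + r *\<^sub>R z"
    using scaleR_left_mono[OF *(4) r] unfolding sum
    by (simp add: scaleR_vector_matrix_assoc scaleR_right_distrib)
  moreover have "c \<bullet> (\<Sum>y\<in>Y. (r * w y) *\<^sub>R y) + (r *\<^sub>R u) \<bullet> b \<le> r * q"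
    using mult_left_mono[OF *(5) r] unfolding sum by (simp add: algebra_simps)
  moreover have "0 \<le> r *\<^sub>R u"
    using * r by (simp add: less_eq_vec_def)
  ultimately show "r *\<^sub>R s \<in> farkas_cone Y c A b"
    unfolding farkas_cone_def s using * r
    by (auto intro!: exI[of _ "\<lambda>y. r * w y"] exI[of _ "r *\<^sub>R u"] simp: sum_distrib_left)
qed

text \<open>A hyperplane separates the point from a closed finitely generated cone;
  \<open>(t, \<delta>, s)\<close> is its normal, with the sign of the first entry reversed. For
  \<open>0 < s\<close>, rescaling \<open>\<delta>\<close> by \<open>1 / s\<close> gives a scenario;
  for \<open>s = 0\<close>, \<open>\<delta>\<close> is a recession direction of the scenario
  constraints.\<close>

lemma farkas_alternative:
  fixes c :: "real ^ 'n" and A :: "real ^ 'n ^ 'k" and b :: "real ^ 'k"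
  assumes "finite Y" and "(p, 0, q) \<notin> farkas_cone Y c A b"
  obtains t \<delta> s where "0 \<le> \<delta>" "0 \<le> s" "A *v \<delta> \<le> s *\<^sub>R b"
    "\<And>y. y \<in> Y \<Longrightarrow> t \<le> (\<delta> + s *\<^sub>R c) \<bullet> y" "s * q < t * p"
proof -
  \<comment> \<open>The generators are a unit weight on one recourse action, a unit of one dual
    variable, a unit of slack in one coordinate of the vector inequality, and a unit of slack in the
    cost bound.\<close>
  define S where "S = (\<lambda>y. (1, y, c \<bullet> y)) ` Y \<union> range (\<lambda>k. (0, - (A $ k), b $ k))
      \<union> range (\<lambda>i. (0, axis i 1, 0)) \<union> {(0 :: real, 0 :: real ^ 'n, 1 :: real)}"
  define K where "K = convex_cone hull S"
  have "S \<subseteq> farkas_cone Y c A b"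
  proof -
    have "(1, y, c \<bullet> y) \<in> farkas_cone Y c A b" if "y \<in> Y" for y
    proof -
      have "(\<Sum>v\<in>Y. (if v = y then 1 else 0) *\<^sub>R v) = y"
        using assms(1) that by (simp add: if_distrib[of "\<lambda>r. r *\<^sub>R _"] cong: if_cong)
      then show ?thesis
        unfolding farkas_cone_def using assms(1) that
        by (auto intro!: exI[of _ "\<lambda>v. if v = y then 1 else 0"] exI[of _ 0])
    qed
    moreover have "(0, - (A $ k), b $ k) \<in> farkas_cone Y c A b" for k
    proof -
      have "axis k 1 v* A = A $ k"
        by (simp add: vec_eq_iff vector_matrix_mult_def axis_def if_distrib[of "\<lambda>r. r * _"]
            if_distrib[of "\<lambda>r. _ * r"] cong: if_cong)
      moreover have "0 \<le> (axis k 1 :: real ^ 'k)"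
        by (simp add: less_eq_vec_def axis_def)
      ultimately show ?thesis
        unfolding farkas_cone_def
        by (auto intro!: exI[of _ "\<lambda>_. 0"] exI[of _ "axis k 1"] simp: inner_axis')
    qed
    moreover have "(0, axis i 1, 0) \<in> farkas_cone Y c A b" for i
      unfolding farkas_cone_def
      by (auto intro!: exI[of _ "\<lambda>_. 0"] exI[of _ 0] simp: less_eq_vec_def axis_def)
    moreover have "(0, 0, 1) \<in> farkas_cone Y c A b"
      unfolding farkas_cone_def by (auto intro!: exI[of _ "\<lambda>_. 0"] exI[of _ 0])
    ultimately show ?thesis
      unfolding S_def by auto
  qed
  then have "K \<subseteq> farkas_cone Y c A b"
    unfolding K_def by (intro hull_minimal convex_cone_farkas_cone)
  with assms(2) have notin: "(p, 0, q) \<notin> K"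
    by blast
  \<comment> \<open>Finitely many generators make the hull closed, which strict separation
    requires.\<close>
  have "finite S"
    unfolding S_def using assms(1) by simp
  then have "closed K" "convex_cone K"
    unfolding K_def by (simp_all add: closed_convex_cone_hull convex_cone_convex_cone_hull)
  then have "convex K" "conic K" "0 \<in> K"
    by (simp_all add: convex_cone_def convex_cone_contains_0)
  from separating_hyperplane_closed_point[OF \<open>convex K\<close> \<open>closed K\<close> notin]
  obtain a r where ar: "a \<bullet> (p, 0, q) < r" "\<And>x. x \<in> K \<Longrightarrow> r < a \<bullet> x"
    by blast
  have "r < 0"
    using ar(2)[OF \<open>0 \<in> K\<close>] by simp
  have nonneg: "0 \<le> a \<bullet> x" if "x \<in> S" for x
  proof (rule ccontr)
    assume "\<not> 0 \<le> a \<bullet> x"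
    then have neg: "a \<bullet> x < 0" by simp
    \<comment> \<open>The factor is positive and moves \<open>x\<close> exactly onto the separating
      hyperplane, where no point of \<open>K\<close> lies.\<close>
    have "(r / (a \<bullet> x)) *\<^sub>R x \<in> K"
      using that neg \<open>r < 0\<close> hull_subset[of S convex_cone]
      by (intro conicD[OF \<open>conic K\<close>]) (auto simp: K_def divide_nonpos_neg)
    from ar(2)[OF this] neg show False
      by simp
  qed
  obtain t' \<delta> s where a: "a = (t', \<delta>, s)"
    by (metis prod_cases3)
  \<comment> \<open>Each kind of generator yields one sign condition; the strict inequality comes
    from the separated point and \<open>r < 0\<close>.\<close>
  show ?thesis
  proof
    show "0 \<le> \<delta>"
      using nonneg[of "(0, axis _ 1, 0)"] unfolding S_def a less_eq_vec_def
      by (auto simp: inner_axis)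
    show "0 \<le> s"
      using nonneg[of "(0, 0, 1)"] unfolding S_def a by simp
    show "A *v \<delta> \<le> s *\<^sub>R b"
      using nonneg[of "(0, - (A $ _), b $ _)"] unfolding S_def a less_eq_vec_def
      by (auto simp: matrix_vector_mul_component inner_commute)
    show "- t' \<le> (\<delta> + s *\<^sub>R c) \<bullet> y" if "y \<in> Y" for y
      using nonneg[of "(1, y, c \<bullet> y)"] that unfolding S_def a
      by (auto simp: inner_add_left)
    show "s * q < - t' * p"
      using ar(1) \<open>r < 0\<close> unfolding a by simp
  qed
qed

section \<open>Scenarios and dual certificates\<close>

lemma uncertainty_set_scale:
  fixes c \<delta> :: "real ^ 'n"
  assumes "0 \<le> \<delta>" "A *v \<delta> \<le> s *\<^sub>R b" "0 < s"
  shows "c + (1 / s) *\<^sub>R \<delta> \<in> uncertainty_set c A b"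
proof -
  have "A *v ((1 / s) *\<^sub>R \<delta>) \<le> b"
    using scaleR_left_mono[OF assms(2), of "1 / s"] assms(3)
    by (simp add: matrix_vector_mult_scaleR)
  moreover have "0 \<le> (1 / s) *\<^sub>R \<delta>"
    using assms(1,3) by (simp add: less_eq_vec_def)
  ultimately show ?thesis
    unfolding uncertainty_set_def by blast
qed

text \<open>Weak duality: writing the scenario as \<open>c + \<delta>\<close>, the extra cost of
  \<open>y\<close> is at most \<open>(u v* A) \<bullet> \<delta>\<close>, hence at most
  \<open>u \<bullet> b\<close>.\<close>

lemma uncertainty_set_inner_le:
  assumes "c' \<in> uncertainty_set c A b" "y \<le> u v* A" "0 \<le> u"
  shows "c' \<bullet> y \<le> c \<bullet> y + u \<bullet> b"
proof -
  obtain \<delta> where \<delta>: "c' = c + \<delta>" "A *v \<delta> \<le> b" "0 \<le> \<delta>"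
    using assms(1) unfolding uncertainty_set_def by auto
  have "y \<bullet> \<delta> \<le> (u v* A) \<bullet> \<delta>"
    using assms(2) \<delta>(3) by (rule inner_left_mono_vec)
  also have "\<dots> = (A *v \<delta>) \<bullet> u"
    by (simp add: dot_lmul_matrix inner_commute[of u])
  also have "\<dots> \<le> b \<bullet> u"
    using \<delta>(2) assms(3) by (rule inner_left_mono_vec)
  finally show ?thesis
    by (simp add: \<delta>(1) inner_add_left inner_commute[of y] inner_commute[of b])
qed

text \<open>With no recourse actions the alternative to such a ray has \<open>0 < s\<close>, which
  rescales to a scenario. The ray serves to refute optimality in the mixed integer program.\<close>

lemma uncertainty_set_empty_ray:
  fixes c :: "real ^ 'n"
  assumes "uncertainty_set c A b = {}"
  obtains u where "0 \<le> u" "0 \<le> u v* A" "u \<bullet> b < 0"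
proof -
  have "(0, 0, -1) \<in> farkas_cone {} c A b"
  proof (rule ccontr)
    assume "(0, 0, -1) \<notin> farkas_cone {} c A b"
    then obtain t \<delta> s where *: "0 \<le> \<delta>" "0 \<le> s" "A *v \<delta> \<le> s *\<^sub>R b" "s * -1 < t * 0"
      by (rule farkas_alternative[OF finite.emptyI]) blast
    then have "0 < s" by simp
    from uncertainty_set_scale[OF *(1,3) this] show False
      using assms by blast
  qed
  then show ?thesis
    using that unfolding farkas_cone_def by force
qed

text \<open>The minimax theorem for the inner game, played by mixed strategies over \<open>Y\<close>, combined with
  strong linear programming duality for the adversary.\<close>

lemma mixed_recourse_dual:
  fixes c :: "real ^ 'n"
  assumes "finite Y" "Y \<noteq> {}"
    and U: "uncertainty_set c A b \<noteq> {}" "bounded (uncertainty_set c A b)"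
    and le: "\<And>c'. c' \<in> uncertainty_set c A b \<Longrightarrow> \<exists>y\<in>Y. c' \<bullet> y \<le> V"
  obtains w u where "\<And>y. y \<in> Y \<Longrightarrow> 0 \<le> w y" "0 \<le> u" "sum w Y = 1"
    "(\<Sum>y\<in>Y. w y *\<^sub>R y) \<le> u v* A" "c \<bullet> (\<Sum>y\<in>Y. w y *\<^sub>R y) + u \<bullet> b \<le> V"
proof -
  have "(1, 0, V) \<in> farkas_cone Y c A b"
  proof (rule ccontr)
    assume "(1, 0, V) \<notin> farkas_cone Y c A b"
    then obtain t \<delta> s where *: "0 \<le> \<delta>" "0 \<le> s" "A *v \<delta> \<le> s *\<^sub>R b"
      "\<And>y. y \<in> Y \<Longrightarrow> t \<le> (\<delta> + s *\<^sub>R c) \<bullet> y" "s * V < t * 1"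
      by (rule farkas_alternative[OF \<open>finite Y\<close>]) blast
    show False
    proof (cases "s = 0")
      \<comment> \<open>Here \<open>\<delta>\<close> is a recession direction of a nonempty bounded
        set, hence zero; then \<open>t\<close> would be both positive and at most 0.\<close>
      case True
      obtain \<delta>0 where \<delta>0: "A *v \<delta>0 \<le> b" "0 \<le> \<delta>0"
        using U(1) unfolding uncertainty_set_def by auto
      have ray: "c + (\<delta>0 + r *\<^sub>R \<delta>) \<in> uncertainty_set c A b" if "0 \<le> r" for r
      proof -
        have "r *\<^sub>R (A *v \<delta>) \<le> 0"
          using scaleR_left_mono[OF *(3) that] True by simp
        then have "A *v (\<delta>0 + r *\<^sub>R \<delta>) \<le> b"
          using add_mono[OF \<delta>0(1), of "r *\<^sub>R (A *v \<delta>)" 0] by (simp add: matrix_vector_right_distrib matrix_vector_mult_scaleR)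
        moreover have "0 \<le> \<delta>0 + r *\<^sub>R \<delta>"
          using \<delta>0(2) *(1) that by (simp add: less_eq_vec_def)
        ultimately show ?thesis
          unfolding uncertainty_set_def by blast
      qed
      obtain B where B: "\<And>z. z \<in> uncertainty_set c A b \<Longrightarrow> norm z \<le> B"
        using U(2) unfolding bounded_iff by blast
      have "\<delta> = 0"
      proof (rule ccontr)
        assume "\<delta> \<noteq> 0"
        \<comment> \<open>Chosen so that \<open>r * norm \<delta>\<close> exceeds by 1 the bound
          \<open>B + norm (c + \<delta>0)\<close> given by the triangle inequality.\<close>
        define r where "r = (B + norm (c + \<delta>0) + 1) / norm \<delta>"
        have "0 \<le> B"
          using B[OF ray[of 0]] norm_ge_zero order_trans by blast
        then have "0 \<le> r"
          unfolding r_def by simp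
        then have "r * norm \<delta> \<le> B + norm (c + \<delta>0)"
          using B[OF ray[of r]] norm_triangle_ineq4[of "c + (\<delta>0 + r *\<^sub>R \<delta>)" "c + \<delta>0"]
          by simp
        then show False
          using \<open>\<delta> \<noteq> 0\<close> unfolding r_def by simp
      qed
      moreover obtain y where "y \<in> Y"
        using \<open>Y \<noteq> {}\<close> by blast
      ultimately show False
        using *(4)[of y] *(5) True by simp
    next
      case False
      \<comment> \<open>In the rescaled scenario every action costs at least \<open>t / s\<close>,
        which is more than \<open>V\<close>, contrary to \<open>le\<close>.\<close>
      then have "0 < s" using *(2) by simp
      obtain y where y: "y \<in> Y" "(c + (1 / s) *\<^sub>R \<delta>) \<bullet> y \<le> V"
        using le uncertainty_set_scale[OF *(1,3) \<open>0 < s\<close>] by blast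
      have "(\<delta> + s *\<^sub>R c) \<bullet> y = s * ((c + (1 / s) *\<^sub>R \<delta>) \<bullet> y)"
        using \<open>0 < s\<close> by (simp add: inner_add_left distrib_left)
      also have "\<dots> \<le> s * V"
        using y(2) \<open>0 < s\<close> by simp
      finally show False
        using *(4)[OF y(1)] *(5) by simp
    qed
  qed
  then show ?thesis
    using that unfolding farkas_cone_def by force
qed

section \<open>Bounds between \<open>Eval\<close> and the two programs\<close>

lemma bdd_above_recourse_cost:
  assumes "bounded U" "recourse H g x \<noteq> {}"
  shows "bdd_above ((\<lambda>c. Min ((\<lambda>y. c \<bullet> y) ` recourse H g x)) ` U)"
proof -
  obtain B where B: "\<And>c. c \<in> U \<Longrightarrow> norm c \<le> B"
    using assms(1) unfolding bounded_iff by blast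
  obtain y where y: "y \<in> recourse H g x"
    using assms(2) by blast
  have "Min ((\<lambda>y. c \<bullet> y) ` recourse H g x) \<le> B * norm y" if "c \<in> U" for c
  proof -
    have "Min ((\<lambda>y. c \<bullet> y) ` recourse H g x) \<le> c \<bullet> y"
      using y finite_recourse by (intro Min_le) auto
    also have "\<dots> \<le> norm c * norm y"
      by (rule norm_cauchy_schwarz)
    also have "\<dots> \<le> B * norm y"
      using B[OF that] by (simp add: mult_right_mono)
    finally show ?thesis .
  qed
  then show ?thesis
    by (intro bdd_aboveI2)
qed

text \<open>This is the hypothesis of \<open>mixed_recourse_dual\<close> with the worst-case
  second-stage cost as \<open>V\<close>.\<close>

lemma ex_recourse_le_Eval:
  assumes "bounded U" "recourse H g x \<noteq> {}" "c \<in> U"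
  shows "\<exists>y\<in>recourse H g x. c \<bullet> y \<le> Eval H g C U x - C \<bullet> x"
proof -
  have "Min ((\<lambda>y. c \<bullet> y) ` recourse H g x) \<in> (\<lambda>y. c \<bullet> y) ` recourse H g x"
    using assms(2) finite_recourse by (intro Min_in) auto
  moreover have "Min ((\<lambda>y. c \<bullet> y) ` recourse H g x) \<le> Eval H g C U x - C \<bullet> x"
    unfolding Eval_def using bdd_above_recourse_cost[OF assms(1,2)] assms(3)
    by (auto intro: cSUP_upper2)
  ultimately show ?thesis
    by auto
qed

lemma Eval_le_program_cost:
  assumes "(x, y, u) \<in> mip_feasible H g A" "uncertainty_set c A b \<noteq> {}"
  shows "Eval H g C (uncertainty_set c A b) x \<le> program_cost C c b (x, y, u)"
proof -
  have y: "y \<in> recourse H g x" "y \<le> u v* A" "0 \<le> u"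
    using assms(1) by (auto simp: mip_feasible_def program_feasible_def recourse_iff)
  have "(SUP c'\<in>uncertainty_set c A b. Min ((\<lambda>y. c' \<bullet> y) ` recourse H g x)) \<le> c \<bullet> y + u \<bullet> b"
  proof (rule cSUP_least[OF assms(2)])
    fix c' assume "c' \<in> uncertainty_set c A b"
    have "Min ((\<lambda>y. c' \<bullet> y) ` recourse H g x) \<le> c' \<bullet> y"
      using y(1) finite_recourse by (intro Min_le) auto
    also have "\<dots> \<le> c \<bullet> y + u \<bullet> b"
      by (rule uncertainty_set_inner_le) fact+
    finally show "Min ((\<lambda>y. c' \<bullet> y) ` recourse H g x) \<le> c \<bullet> y + u \<bullet> b" .
  qed
  then show ?thesis
    by (simp add: Eval_def program_cost_def)
qed

text \<open>Neither \<open>c \<bullet> y\<close> nor \<open>u \<bullet> b\<close> need be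
  nonnegative alone, but by weak duality their sum dominates the cost of \<open>y\<close> in any one
  scenario.\<close>

lemma program_cost_nonneg:
  fixes c :: "real ^ 'n"
  assumes "0 \<le> C" "uncertainty_set c A b \<noteq> {}" "uncertainty_set c A b \<subseteq> {c'. 0 \<le> c'}"
    and "z \<in> lp_feasible H g A"
  shows "0 \<le> program_cost C c b z"
proof -
  obtain x y u where z: "z = (x, y, u)"
    by (metis prod_cases3)
  have f: "0 \<le> x" "0 \<le> y" "y \<le> u v* A" "0 \<le> u"
    using assms(4) by (auto simp: z lp_feasible_def program_feasible_def)
  obtain c' where c': "c' \<in> uncertainty_set c A b"
    using assms(2) by blast
  have "0 \<le> c' \<bullet> y"
    using c' assms(3) f by (intro inner_nonneg_vec) auto
  also have "\<dots> \<le> c \<bullet> y + u \<bullet> b"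
    by (rule uncertainty_set_inner_le) fact+
  finally show ?thesis
    using inner_nonneg_vec[OF assms(1) f(1)] by (simp add: z program_cost_def)
qed

text \<open>The mixed recourse with its dual certificate is a point of the relaxation: the
  constraints on \<open>y\<close> that hold for each pure action define a convex set.\<close>

lemma lp_opt_le_Eval:
  fixes c :: "real ^ 'n"
  assumes "0 \<le> C"
    and U: "uncertainty_set c A b \<noteq> {}" "bounded (uncertainty_set c A b)"
      "uncertainty_set c A b \<subseteq> {c'. 0 \<le> c'}"
    and x: "x \<in> first_stage H g"
  shows "lp_opt H g C c A b \<le> Eval H g C (uncertainty_set c A b) x"
proof -
  let ?R = "recourse H g x"
  let ?V = "Eval H g C (uncertainty_set c A b) x - C \<bullet> x"
  have xb: "x \<in> binary_vectors" and R: "?R \<noteq> {}"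
    using x by (auto simp: first_stage_def)
  obtain w u where w: "\<And>y. y \<in> ?R \<Longrightarrow> 0 \<le> w y" "0 \<le> u" "sum w ?R = 1"
    "(\<Sum>y\<in>?R. w y *\<^sub>R y) \<le> u v* A" "c \<bullet> (\<Sum>y\<in>?R. w y *\<^sub>R y) + u \<bullet> b \<le> ?V"
    using mixed_recourse_dual[OF finite_recourse R U(1,2) ex_recourse_le_Eval[OF U(2) R]] by blast
  define z where "z = (\<Sum>y\<in>?R. w y *\<^sub>R y)"
  let ?P = "{y. 0 \<le> y \<and> y \<le> 1 \<and> x + y \<le> 1 \<and> g \<le> H *v (y + x)}"
  have "convex ?P"
  proof -
    have "?P = {0..} \<inter> {..1} \<inter> {..1 - x} \<inter> (\<lambda>y. H *v y) -` {g - H *v x..}"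
      by (auto simp: matrix_vector_right_distrib algebra_simps)
    then show ?thesis
      by (simp add: convex_Int convex_linear_vimage is_interval_convex is_interval_ci is_interval_ic)
  qed
  moreover have "?R \<subseteq> ?P"
    using binary_vectors_bounds by (auto simp: recourse_iff[OF xb])
  ultimately have "z \<in> ?P"
    unfolding z_def using w(1,3) finite_recourse by (intro convex_sum) auto
  then have f: "(x, z, u) \<in> lp_feasible H g A"
    using binary_vectors_bounds[OF xb] w(2,4)
    by (auto simp: lp_feasible_def program_feasible_def z_def)
  \<comment> \<open>The lower bound 0 on all costs makes the real infimum a genuine lower
    bound.\<close>
  have "lp_opt H g C c A b \<le> program_cost C c b (x, z, u)"
    unfolding lp_opt_def using program_cost_nonneg[OF assms(1) U(1,3)] f
    by (intro cINF_lower bdd_belowI2[of _ 0])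
  also have "\<dots> \<le> Eval H g C (uncertainty_set c A b) x"
    using w(5) by (simp add: program_cost_def z_def)
  finally show ?thesis .
qed

text \<open>Both stages cost at least 0, so a total of 0 forces each stage to cost 0.\<close>

lemma Eval_bounds:
  assumes "0 \<le> C" "bounded U" "U \<noteq> {}" "U \<subseteq> {c. 0 \<le> c}" "x \<in> first_stage H g"
  shows "0 \<le> C \<bullet> x" "C \<bullet> x \<le> Eval H g C U x"
proof -
  have R: "recourse H g x \<noteq> {}" and "x \<in> binary_vectors"
    using assms(5) by (auto simp: first_stage_def)
  then show "0 \<le> C \<bullet> x"
    using assms(1) by (simp add: inner_nonneg_vec binary_vectors_bounds)
  obtain c where "c \<in> U" using assms(3) by blast
  then obtain y where y: "y \<in> recourse H g x" "c \<bullet> y \<le> Eval H g C U x - C \<bullet> x"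
    using ex_recourse_le_Eval[OF assms(2) R] by blast
  have "0 \<le> c \<bullet> y"
    using y(1) \<open>c \<in> U\<close> assms(4)
    by (intro inner_nonneg_vec) (auto simp: recourse_def binary_vectors_bounds)
  then show "C \<bullet> x \<le> Eval H g C U x"
    using y(2) by simp
qed

text \<open>When an optimal mixed recourse costs nothing in every scenario, neither does any pure recourse
  in its support.\<close>

lemma mip_feasible_cost_zero:
  fixes c :: "real ^ 'n"
  assumes "0 \<le> C"
    and U: "uncertainty_set c A b \<noteq> {}" "bounded (uncertainty_set c A b)"
      "uncertainty_set c A b \<subseteq> {c'. 0 \<le> c'}"
    and x: "x \<in> first_stage H g" and zero: "Eval H g C (uncertainty_set c A b) x \<le> 0"
  shows "\<exists>z\<in>mip_feasible H g A. program_cost C c b z \<le> 0"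
proof -
  let ?R = "recourse H g x"
  have xb: "x \<in> binary_vectors" and R: "?R \<noteq> {}"
    using x by (auto simp: first_stage_def)
  have Cx: "C \<bullet> x = 0" and E: "Eval H g C (uncertainty_set c A b) x - C \<bullet> x = 0"
    using Eval_bounds[OF assms(1) U(2,1,3) x] zero by simp_all
  obtain w u where w: "\<And>y. y \<in> ?R \<Longrightarrow> 0 \<le> w y" "0 \<le> u" "sum w ?R = 1"
    "(\<Sum>y\<in>?R. w y *\<^sub>R y) \<le> u v* A" "c \<bullet> (\<Sum>y\<in>?R. w y *\<^sub>R y) + u \<bullet> b \<le> 0"
    using mixed_recourse_dual[OF finite_recourse R U(1,2) ex_recourse_le_Eval[OF U(2) R, of _ C]]
    unfolding E by blast
  obtain y where y: "y \<in> ?R" "w y \<noteq> 0"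
    using w(3) by (metis sum.neutral zero_neq_one)
  have "c' \<bullet> y \<le> 0" if c': "c' \<in> uncertainty_set c A b" for c'
  proof -
    \<comment> \<open>The mixture costs at most 0 and all its terms are nonnegative, so the term of
      \<open>y\<close>, which has positive weight, is at most 0.\<close>
    have nn: "0 \<le> w v * (c' \<bullet> v)" if "v \<in> ?R" for v
      using w(1)[OF that] that c' U(3)
      by (intro mult_nonneg_nonneg inner_nonneg_vec) (auto simp: recourse_def binary_vectors_bounds)
    have "w y * (c' \<bullet> y) \<le> (\<Sum>v\<in>?R. w v * (c' \<bullet> v))"
      using y(1) nn finite_recourse by (intro member_le_sum) auto
    also have "\<dots> = c' \<bullet> (\<Sum>v\<in>?R. w v *\<^sub>R v)"
      by (simp add: inner_sum_right)
    also have "\<dots> \<le> 0"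
      using uncertainty_set_inner_le[OF c' w(4,2)] w(5) by simp
    finally show ?thesis
      using w(1)[OF y(1)] y(2) by (simp add: mult_le_0_iff)
  qed
  \<comment> \<open>The only mixed strategy over \<open>{y}\<close> is \<open>y\<close> itself, so
    duality now certifies a binary action.\<close>
  then obtain w' u' where "0 \<le> u'" "sum w' {y} = 1" "(\<Sum>v\<in>{y}. w' v *\<^sub>R v) \<le> u' v* A"
    "c \<bullet> (\<Sum>v\<in>{y}. w' v *\<^sub>R v) + u' \<bullet> b \<le> 0"
    using mixed_recourse_dual[of "{y}" c A b 0] U(1,2) by blast
  then have "(x, y, u') \<in> mip_feasible H g A" "program_cost C c b (x, y, u') \<le> 0"
    using y(1) xb Cx by (auto simp: mip_feasible_def program_feasible_def program_cost_def recourse_iff)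
  then show ?thesis
    by blast
qed

section \<open>Comparison of the mixed integer, relaxed and two-stage optima\<close>

theorem theorem6:
  fixes H :: "real ^ 'n ^ 'm" and g :: "real ^ 'm"
    and A :: "real ^ 'n ^ 'k" and b :: "real ^ 'k"
    and C c :: "real ^ 'n"
    and x y :: "real ^ 'n" and u :: "real ^ 'k"
  assumes "0 \<le> C"
    and "bounded (uncertainty_set c A b)"
    and "uncertainty_set c A b \<subseteq> {c'. 0 \<le> c'}"
    and "is_arg_min (program_cost C c b) (\<lambda>z. z \<in> mip_feasible H g A) (x, y, u)"
  shows "x \<in> first_stage H g \<and>
    ereal (Eval H g C (uncertainty_set c A b) x)
      \<le> integrality_gap H g C c A b
          * ereal (robust_two_stage_opt H g C (uncertainty_set c A b))"
proof
  let ?U = "uncertainty_set c A b"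
  let ?M = "program_cost C c b (x, y, u)"
  let ?L = "lp_opt H g C c A b"
  let ?O = "robust_two_stage_opt H g C ?U"
  have feas: "(x, y, u) \<in> mip_feasible H g A"
    and opt: "\<And>z. z \<in> mip_feasible H g A \<Longrightarrow> ?M \<le> program_cost C c b z"
    using assms(4) by (auto simp: is_arg_min_linorder)
  then show x: "x \<in> first_stage H g"
    by (auto simp: mip_feasible_def program_feasible_def first_stage_def recourse_iff)
  have U: "?U \<noteq> {}"
  proof
    assume "?U = {}"
    then obtain v where v: "0 \<le> v" "0 \<le> v v* A" "v \<bullet> b < 0"
      by (rule uncertainty_set_empty_ray)
    \<comment> \<open>Adding the ray to \<open>u\<close> keeps feasibility and strictly lowers the
      cost.\<close>
    have "y \<le> (u + v) v* A" "0 \<le> u + v"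
      using feas v add_mono[of y "u v* A" 0 "v v* A"]
      by (auto simp: mip_feasible_def program_feasible_def vector_matrix_left_distrib)
    then have "(x, y, u + v) \<in> mip_feasible H g A"
      using feas by (auto simp: mip_feasible_def program_feasible_def)
    from opt[OF this] v(3) show False
      by (simp add: program_cost_def inner_add_left)
  qed
  have mip: "mip_opt H g C c A b = ?M"
    unfolding mip_opt_def using feas opt by (intro cInf_eq_minimum) auto
  have sub: "mip_feasible H g A \<subseteq> lp_feasible H g A"
    using binary_vectors_bounds
    by (auto simp: mip_feasible_def lp_feasible_def program_feasible_def)
  have L: "0 \<le> ?L"
    unfolding lp_opt_def using program_cost_nonneg[OF assms(1) U assms(3)] feas sub
    by (intro cINF_greatest) auto
  have M: "0 \<le> ?M"
    using program_cost_nonneg[OF assms(1) U assms(3)] feas sub by blast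
  have EM: "Eval H g C ?U x \<le> ?M"
    using feas U by (rule Eval_le_program_cost)
  have "finite (first_stage H g)"
    unfolding first_stage_def by (rule finite_subset[OF _ finite_binary_vectors]) auto
  then have "?O \<in> Eval H g C ?U ` first_stage H g"
    unfolding robust_two_stage_opt_def using x by (intro Min_in) auto
  then obtain x' where x': "x' \<in> first_stage H g" "?O = Eval H g C ?U x'"
    by blast
  have LO: "?L \<le> ?O"
    unfolding x'(2) using assms(1) U assms(2,3) x'(1) by (rule lp_opt_le_Eval)
  show "ereal (Eval H g C ?U x) \<le> integrality_gap H g C c A b * ereal ?O"
  proof (cases "?L = 0")
    case False
    then have "0 < ?L" using L by simp
    then have "?M * ?L \<le> ?M * ?O" using LO M by (intro mult_left_mono)
    then have "?M \<le> ?M / ?L * ?O"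
      using \<open>0 < ?L\<close> by (simp add: field_simps)
    then show ?thesis
      using EM False by (simp add: integrality_gap_def mip)
  next
    case True
    show ?thesis
    proof (cases "?M = 0")
      case True
      \<comment> \<open>The gap is \<open>0 / 0 = 0\<close> in \<open>ereal\<close>, so the
        right-hand side is 0; \<open>EM\<close> bounds \<open>Eval\<close> by 0 as well.\<close>
      then show ?thesis
        using EM \<open>?L = 0\<close> by (simp add: integrality_gap_def mip)
    next
      case False
      then have "0 < ?M" using M by simp
      \<comment> \<open>The gap is infinite here, so the product is infinite once \<open>?O\<close>
        is positive; a value of at most 0 would give a mixed integer point cheaper than
        \<open>?M\<close>.\<close>
      then have "\<not> ?O \<le> 0"
        using mip_feasible_cost_zero[OF assms(1) U assms(2,3) x'(1)] opt x'(2)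
        by (metis not_le order_trans)
      then show ?thesis
        using \<open>0 < ?M\<close> \<open>?L = 0\<close> by (simp add: integrality_gap_def mip)
    qed
  qed
qed

end
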